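(* Let $m$ be a positive odd integer with even root $2b$, where $b \geq 1$ is an odd integer (so $m = 2(2b)+1$). Let $x$ be the largest exponent such that $2^x$ divides $3m+1$. Then $x \ge 3$ and the root of $R(m) = \frac{3m+1}{2^x}$ is $$\frac{3b + 1 - 2^{x-2}}{2^{x-1}}.$$
   Context: For a positive odd integer $m$, the root of $m$ is the integer $a \ge 0$ with $m = 2a+1$. The reduced Collatz iteration sends a positive odd integer $m$ to $R(m) = \frac{3m+1}{2^x}$, where $2^x$ is the highest power of $2$ dividing $3m+1$. *)

theory Defs
  imports Complex_Main "HOL-Computational_Algebra.Primes"
begin

(* Specified only for odd m; the name avoids the n-th root function root of Complex_Main. *)
definition odd_root :: "nat \<Rightarrow> nat" where
  "odd_root m = (THE a. m = 2 * a + 1)"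

(* The divisor is a power of 2 dividing 3 * m + 1, so div is exact here. *)
definition reduced_collatz :: "nat \<Rightarrow> nat" where
  "reduced_collatz m = (3 * m + 1) div 2 ^ multiplicity 2 (3 * m + 1)"

end

theory Submission
  imports Defs
begin

text \<open>Since \<open>m = 4 * b + 1\<close>, we have \<open>3 * m + 1 = 4 * (3 * b + 1)\<close>,
  and \<open>3 * b + 1\<close> is even for odd \<open>b\<close>; hence 8 divides
  \<open>3 * m + 1\<close>. Writing the odd part of \<open>3 * m + 1\<close> as
  \<open>2 * a + 1\<close> and cancelling 4 leaves
  \<open>3 * b + 1 = 2 ^ (x - 2) * (2 * a + 1)\<close>, which is linear in the wanted root
  \<open>a\<close>.\<close>

lemma odd_root_double_plus_one: "odd_root (2 * a + 1) = a"
  unfolding odd_root_def by (rule the_equality) auto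

theorem theorem6:
  fixes m b x :: nat
  assumes "m > 0" and "odd m"
    and "b \<ge> 1" and "odd b"
    and "odd_root m = 2 * b"
    and "x = multiplicity 2 (3 * m + 1)"
  shows "x \<ge> 3 \<and>
    real (odd_root (reduced_collatz m)) = (3 * real b + 1 - 2 ^ (x - 2)) / 2 ^ (x - 1)"
proof -
  have m: "m = 4 * b + 1"
    using assms(2,5) odd_root_double_plus_one by (elim oddE) simp
  obtain c where c: "b = 2 * c + 1"
    using \<open>odd b\<close> by (auto elim: oddE)
  have "2 ^ 3 dvd 3 * m + 1"
    \<comment> \<open>Here \<open>3 * m + 1 = 12 * b + 4 = 24 * c + 16\<close>.\<close>
    unfolding m c by (intro dvdI[of _ _ "3 * c + 2"]) simp
  then have x3: "x \<ge> 3"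
    unfolding assms(6) by (intro multiplicity_geI) auto
  obtain r where r: "3 * m + 1 = 2 ^ x * r" "\<not> 2 dvd r"
    using multiplicity_decompose'[of "3 * m + 1" "2::nat"] assms(6) by auto
  obtain a where a: "r = 2 * a + 1"
    using r(2) by (auto elim: oddE)
  have "reduced_collatz m = r"
    unfolding reduced_collatz_def assms(6)[symmetric] by (subst r(1)) simp
  then have root: "odd_root (reduced_collatz m) = a"
    using a odd_root_double_plus_one by simp
  \<comment> \<open>With \<open>k\<close> for \<open>x - 2\<close>, the exponents involve no
    truncated subtraction, and the factor \<open>2 ^ 2\<close> of \<open>2 ^ x\<close> can be
    cancelled.\<close>
  obtain k where k: "x = k + 2"
    using x3 that[of "x - 2"] by simp
  have "3 * b + 1 = 2 ^ k * (2 * a + 1)"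
    using r(1) unfolding m a k by (simp add: power_add)
  \<comment> \<open>The subtraction in the goal is over the reals, so the equation is moved there
    before solving for \<open>a\<close>.\<close>
  from arg_cong[OF this, of real] have "3 * real b + 1 = 2 ^ k * (2 * real a + 1)"
    by (simp add: algebra_simps)
  then show ?thesis
    using x3 unfolding root k by (simp add: field_simps)
qed

end
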